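(* The category $\mathbf{Co\text{-}NOE}$ of all $T_0$ co-Noetherian spaces with continuous maps and the category $\mathbf{C\text{-}DCPO}$ of all controllable dcpos with upper-continuous maps are equivalent categories.
   Context: A filter basis of sets is a nonempty family of sets such that any two members contain a third member of the family. A topological space $(X,\tau)$ is co-Noetherian if for each open set $V$ and each filter basis $\mathcal{U}$ of open sets with $\bigcap\mathcal{U}\subseteq V$, there is a $U\in\mathcal{U}$ with $U\subseteq V$. A dcpo is a poset in which every (nonempty) directed subset has a supremum. For a subset $A$ of a poset $P$, $\downarrow A=\{x\in P: x\le a \text{ for some } a\in A\}$ and $\downarrow y=\downarrow\{y\}$. Let $L$ be a dcpo and $C$ an anti-chain of $L$ (a set of pairwise incomparable elements). A finite anti-chain $F\subseteq L$ is called a cover of $C$ if $C\subseteq\downarrow F$ and, for each finite $G\subseteq L$, $C\subseteq\downarrow G$ implies $F\subseteq\downarrow G$. A dcpo $L$ is called controllable if every anti-chain $C$ of $L$ has a cover. A map $f:L\to M$ between dcpos is called upper-continuous if $f$ is monotone and, for each $y\in M$, $f^{-1}(\downarrow y)$ has a finite number of maximal points.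
   Formalization: Upper-continuity also requires each point of f^{-1}(↓y) to lie below one of its finitely many maximal points (otherwise such maps are not closed under composition); spaces and dcpos range over subsets of an arbitrary fixed universe. *)

theory Defs
  imports "HOL-Analysis.Analysis"
begin

section \<open>Categories, functors and equivalence of categories\<close>

text \<open>
  Hom-sets are not required to be disjoint, so composition and the action of a functor on
  morphisms carry the relevant objects as arguments: \<open>Comp C a b c g f\<close> is the composite of
  \<open>f \<in> Hom C a b\<close> with \<open>g \<in> Hom C b c\<close>. Values outside \<open>Obj\<close> and \<open>Hom\<close> are irrelevant.
\<close>

record ('o, 'm) cat =
  Obj :: "'o set"
  Hom :: "'o \<Rightarrow> 'o \<Rightarrow> 'm set"
  Ident :: "'o \<Rightarrow> 'm"
  Comp :: "'o \<Rightarrow> 'o \<Rightarrow> 'o \<Rightarrow> 'm \<Rightarrow> 'm \<Rightarrow> 'm"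

locale category =
  fixes C :: "('o, 'm) cat"
  assumes ident_in_hom: "a \<in> Obj C \<Longrightarrow> Ident C a \<in> Hom C a a"
    and comp_in_hom:
      "\<lbrakk>a \<in> Obj C; b \<in> Obj C; c \<in> Obj C; f \<in> Hom C a b; g \<in> Hom C b c\<rbrakk>
        \<Longrightarrow> Comp C a b c g f \<in> Hom C a c"
    and comp_ident_right:
      "\<lbrakk>a \<in> Obj C; b \<in> Obj C; f \<in> Hom C a b\<rbrakk> \<Longrightarrow> Comp C a a b f (Ident C a) = f"
    and comp_ident_left:
      "\<lbrakk>a \<in> Obj C; b \<in> Obj C; f \<in> Hom C a b\<rbrakk> \<Longrightarrow> Comp C a b b (Ident C b) f = f"
    and comp_assoc:
      "\<lbrakk>a \<in> Obj C; b \<in> Obj C; c \<in> Obj C; d \<in> Obj C;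
        f \<in> Hom C a b; g \<in> Hom C b c; h \<in> Hom C c d\<rbrakk>
        \<Longrightarrow> Comp C a b d (Comp C b c d h g) f = Comp C a c d h (Comp C a b c g f)"

record ('o, 'm, 'p, 'n) fctr =
  on_obj :: "'o \<Rightarrow> 'p"
  on_hom :: "'o \<Rightarrow> 'o \<Rightarrow> 'm \<Rightarrow> 'n"

locale is_functor = C: category C + D: category D
  for C :: "('o, 'm) cat" and D :: "('p, 'n) cat" +
  fixes F :: "('o, 'm, 'p, 'n) fctr"
  assumes on_obj: "a \<in> Obj C \<Longrightarrow> on_obj F a \<in> Obj D"
    and on_hom:
      "\<lbrakk>a \<in> Obj C; b \<in> Obj C; f \<in> Hom C a b\<rbrakk>
        \<Longrightarrow> on_hom F a b f \<in> Hom D (on_obj F a) (on_obj F b)"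
    and on_ident: "a \<in> Obj C \<Longrightarrow> on_hom F a a (Ident C a) = Ident D (on_obj F a)"
    and on_comp:
      "\<lbrakk>a \<in> Obj C; b \<in> Obj C; c \<in> Obj C; f \<in> Hom C a b; g \<in> Hom C b c\<rbrakk>
        \<Longrightarrow> on_hom F a c (Comp C a b c g f)
          = Comp D (on_obj F a) (on_obj F b) (on_obj F c) (on_hom F b c g) (on_hom F a b f)"

definition id_functor :: "('o, 'm, 'o, 'm) fctr"
  where "id_functor = \<lparr>on_obj = (\<lambda>a. a), on_hom = (\<lambda>a b f. f)\<rparr>"

definition comp_functor ::
    "('p, 'n, 'q, 'k) fctr \<Rightarrow> ('o, 'm, 'p, 'n) fctr \<Rightarrow> ('o, 'm, 'q, 'k) fctr"
  where "comp_functor G F =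
    \<lparr>on_obj = (\<lambda>a. on_obj G (on_obj F a)),
     on_hom = (\<lambda>a b f. on_hom G (on_obj F a) (on_obj F b) (on_hom F a b f))\<rparr>"

definition isomorphism :: "('o, 'm) cat \<Rightarrow> 'o \<Rightarrow> 'o \<Rightarrow> 'm \<Rightarrow> bool"
  where "isomorphism C a b f \<longleftrightarrow>
    f \<in> Hom C a b \<and>
    (\<exists>g\<in>Hom C b a. Comp C a b a g f = Ident C a \<and> Comp C b a b f g = Ident C b)"

definition natural_isomorphism ::
    "('o, 'm) cat \<Rightarrow> ('p, 'n) cat \<Rightarrow> ('o, 'm, 'p, 'n) fctr \<Rightarrow> ('o, 'm, 'p, 'n) fctr
      \<Rightarrow> ('o \<Rightarrow> 'n) \<Rightarrow> bool"
  where "natural_isomorphism C D F G \<eta> \<longleftrightarrow>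
    is_functor C D F \<and> is_functor C D G \<and>
    (\<forall>a\<in>Obj C. isomorphism D (on_obj F a) (on_obj G a) (\<eta> a)) \<and>
    (\<forall>a\<in>Obj C. \<forall>b\<in>Obj C. \<forall>f\<in>Hom C a b.
      Comp D (on_obj F a) (on_obj F b) (on_obj G b) (\<eta> b) (on_hom F a b f)
      = Comp D (on_obj F a) (on_obj G a) (on_obj G b) (on_hom G a b f) (\<eta> a))"

text \<open>The locale \<open>is_functor\<close> contains the category axioms for both \<open>C\<close> and \<open>D\<close>.\<close>

definition equivalent_categories :: "('o, 'm) cat \<Rightarrow> ('p, 'n) cat \<Rightarrow> bool"
  where "equivalent_categories C D \<longleftrightarrow>
    (\<exists>F G \<eta> \<epsilon>.
      is_functor C D F \<and> is_functor D C G \<and>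
      natural_isomorphism C C id_functor (comp_functor G F) \<eta> \<and>
      natural_isomorphism D D (comp_functor F G) id_functor \<epsilon>)"


section \<open>Co-Noetherian spaces\<close>

definition filter_basis :: "'a set set \<Rightarrow> bool"
  where "filter_basis \<U> \<longleftrightarrow> \<U> \<noteq> {} \<and> (\<forall>A\<in>\<U>. \<forall>B\<in>\<U>. \<exists>W\<in>\<U>. W \<subseteq> A \<inter> B)"

definition co_noetherian_space :: "'a topology \<Rightarrow> bool"
  where "co_noetherian_space X \<longleftrightarrow>
    (\<forall>V \<U>. openin X V \<and> filter_basis \<U> \<and> (\<forall>U\<in>\<U>. openin X U) \<and> \<Inter>\<U> \<subseteq> V
      \<longrightarrow> (\<exists>U\<in>\<U>. U \<subseteq> V))"

text \<open>
  The type \<open>'a\<close> is the universe in which the points of the spaces live: an object is a topology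
  on an arbitrary subset (\<open>topspace X\<close>) of \<open>'a\<close>. Maps are made extensional so that equality of
  morphisms is equality of maps on \<open>topspace X\<close>.
\<close>

definition Co_NOE :: "('a topology, 'a \<Rightarrow> 'a) cat"
  where "Co_NOE =
    \<lparr>Obj = {X. t0_space X \<and> co_noetherian_space X},
     Hom = (\<lambda>X Y. {f \<in> extensional (topspace X). continuous_map X Y f}),
     Ident = (\<lambda>X. \<lambda>x\<in>topspace X. x),
     Comp = (\<lambda>X Y Z g f. compose (topspace X) g f)\<rparr>"


section \<open>Controllable dcpos\<close>

text \<open>
  A poset is a relation \<open>r\<close> with \<^prop>\<open>Partial_order r\<close>; by reflexivity its underlying set is
  \<^term>\<open>Field r\<close>, and \<open>(x, y) \<in> r\<close> means \<open>x \<le> y\<close>.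
\<close>

definition directed :: "'a rel \<Rightarrow> 'a set \<Rightarrow> bool"
  where "directed r D \<longleftrightarrow>
    D \<subseteq> Field r \<and> D \<noteq> {} \<and> (\<forall>x\<in>D. \<forall>y\<in>D. \<exists>z\<in>D. (x, z) \<in> r \<and> (y, z) \<in> r)"

definition is_supremum :: "'a rel \<Rightarrow> 'a set \<Rightarrow> 'a \<Rightarrow> bool"
  where "is_supremum r A s \<longleftrightarrow> s \<in> Above r A \<and> (\<forall>u\<in>Above r A. (s, u) \<in> r)"

definition dcpo :: "'a rel \<Rightarrow> bool"
  where "dcpo r \<longleftrightarrow> Partial_order r \<and> (\<forall>D. directed r D \<longrightarrow> (\<exists>s. is_supremum r D s))"

definition downset :: "'a rel \<Rightarrow> 'a set \<Rightarrow> 'a set"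
  where "downset r A = {x \<in> Field r. \<exists>a\<in>A. (x, a) \<in> r}"

definition antichain :: "'a rel \<Rightarrow> 'a set \<Rightarrow> bool"
  where "antichain r C \<longleftrightarrow> C \<subseteq> Field r \<and> (\<forall>x\<in>C. \<forall>y\<in>C. x \<noteq> y \<longrightarrow> (x, y) \<notin> r)"

definition is_cover :: "'a rel \<Rightarrow> 'a set \<Rightarrow> 'a set \<Rightarrow> bool"
  where "is_cover r C F \<longleftrightarrow>
    finite F \<and> antichain r F \<and> C \<subseteq> downset r F \<and>
    (\<forall>G. finite G \<and> G \<subseteq> Field r \<and> C \<subseteq> downset r G \<longrightarrow> F \<subseteq> downset r G)"

definition controllable :: "'a rel \<Rightarrow> bool"
  where "controllable r \<longleftrightarrow> dcpo r \<and> (\<forall>C. antichain r C \<longrightarrow> (\<exists>F. is_cover r C F))"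

definition maximal_points :: "'a rel \<Rightarrow> 'a set \<Rightarrow> 'a set"
  where "maximal_points r S = {m \<in> S. \<forall>x\<in>S. (m, x) \<in> r \<longrightarrow> x = m}"

text \<open>
  That \<open>f\<inverse>(\<down>y)\<close> has a finite number of maximal points is understood as: its maximal points are
  finite in number and every point of \<open>f\<inverse>(\<down>y)\<close> lies below one of them. Finiteness of the set of
  maximal points alone would also admit preimages without any maximal point, and the resulting
  class of maps is not closed under composition. For instance, let \<open>L\<close> be an infinite antichain
  \<open>a\<^sub>0, a\<^sub>1, \<dots>\<close> with a top element adjoined, let \<open>f : L \<rightarrow> \<omega> + 1\<close> send \<open>a\<^sub>n\<close> to \<open>n\<close> and the top
  to \<open>\<omega>\<close>, and let \<open>g : \<omega> + 1 \<rightarrow> {0 < 1}\<close> send each \<open>n\<close> to \<open>0\<close> and \<open>\<omega>\<close> to \<open>1\<close>: the preimage of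
  \<open>\<down>0\<close> has no maximal point under \<open>g\<close> and infinitely many under \<open>g \<circ> f\<close>.
\<close>

definition upper_continuous :: "'a rel \<Rightarrow> 'b rel \<Rightarrow> ('a \<Rightarrow> 'b) \<Rightarrow> bool"
  where "upper_continuous r s f \<longleftrightarrow>
    f \<in> Field r \<rightarrow> Field s \<and>
    (\<forall>x y. (x, y) \<in> r \<longrightarrow> (f x, f y) \<in> s) \<and>
    (\<forall>y\<in>Field s.
      let S = {x \<in> Field r. f x \<in> downset s {y}}
      in finite (maximal_points r S) \<and> S \<subseteq> downset r (maximal_points r S))"

definition C_DCPO :: "('a rel, 'a \<Rightarrow> 'a) cat"
  where "C_DCPO =
    \<lparr>Obj = {r. controllable r},
     Hom = (\<lambda>r s. {f \<in> extensional (Field r). upper_continuous r s f}),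
     Ident = (\<lambda>r. \<lambda>x\<in>Field r. x),
     Comp = (\<lambda>r s t g f. compose (Field r) g f)\<rparr>"

end

theory Submission
  imports Defs
begin

text \<open>
  In a co-Noetherian space every closed set \<open>A\<close> is the union of the directed family of closures
  of its finite subsets, hence equal to one of them: the closed sets are exactly the finitely
  generated lower sets of the specialization order, and \<open>X\<close> is determined by that order. A partial
  order arises in this way if and only if its finitely generated lower sets are closed under
  arbitrary intersections, and by Zorn's lemma this holds if and only if it is a controllable dcpo.
  Under this correspondence continuity is upper-continuity, so the two categories are even
  isomorphic, and the natural isomorphisms consist of identities.
\<close>

section \<open>Finitely generated lower sets\<close>

text \<open>The empty \<open>F\<close> is allowed, so the empty set counts. These sets are going to
  be the closed sets of the corresponding space.\<close>

definition finitely_generated :: "'a rel \<Rightarrow> 'a set \<Rightarrow> bool"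
  where "finitely_generated r A \<longleftrightarrow> (\<exists>F. finite F \<and> F \<subseteq> Field r \<and> A = downset r F)"

lemma Partial_order_refl: "Partial_order r \<Longrightarrow> x \<in> Field r \<Longrightarrow> (x, x) \<in> r"
  by (simp add: partial_order_on_def preorder_on_def refl_on_def)

lemma Partial_order_trans: "Partial_order r \<Longrightarrow> (x, y) \<in> r \<Longrightarrow> (y, z) \<in> r \<Longrightarrow> (x, z) \<in> r"
  by (meson partial_order_on_def preorder_on_def transD)

lemma Partial_order_antisym: "Partial_order r \<Longrightarrow> (x, y) \<in> r \<Longrightarrow> (y, x) \<in> r \<Longrightarrow> x = y"
  by (meson partial_order_on_def antisymD)

lemma in_downset_iff: "x \<in> downset r F \<longleftrightarrow> (\<exists>a\<in>F. (x, a) \<in> r)"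
  by (auto simp: downset_def intro: FieldI1)

lemma downset_subset_Field: "downset r F \<subseteq> Field r"
  by (auto simp: downset_def)

lemma subset_downset: "Partial_order r \<Longrightarrow> F \<subseteq> Field r \<Longrightarrow> F \<subseteq> downset r F"
  using Partial_order_refl by (fastforce simp: in_downset_iff)

lemma downset_subset_iff:
  assumes "Partial_order r" "F \<subseteq> Field r"
  shows "downset r F \<subseteq> downset r G \<longleftrightarrow> F \<subseteq> downset r G"
  using subset_downset[OF assms] Partial_order_trans[OF assms(1)]
  unfolding subset_iff in_downset_iff by meson

lemma downset_Un: "downset r (F \<union> G) = downset r F \<union> downset r G"
  by (auto simp: downset_def)

lemma finitely_generated_downset:
  "finite F \<Longrightarrow> F \<subseteq> Field r \<Longrightarrow> finitely_generated r (downset r F)"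
  by (auto simp: finitely_generated_def)

lemma finitely_generated_empty: "finitely_generated r {}"
  unfolding finitely_generated_def by (intro exI[of _ "{}"]) (auto simp: downset_def)

lemma finitely_generated_Un:
  "finitely_generated r A \<Longrightarrow> finitely_generated r B \<Longrightarrow> finitely_generated r (A \<union> B)"
  unfolding finitely_generated_def by (metis downset_Un finite_UnI le_sup_iff)

lemma finitely_generated_UN:
  "finite I \<Longrightarrow> (\<And>i. i \<in> I \<Longrightarrow> finitely_generated r (A i)) \<Longrightarrow> finitely_generated r (\<Union>i\<in>I. A i)"
  by (induction I rule: finite_induct) (auto intro: finitely_generated_empty finitely_generated_Un)

lemma finitely_generated_subset: "finitely_generated r A \<Longrightarrow> A \<subseteq> Field r"
  by (auto simp: finitely_generated_def downset_def)

section \<open>Maximal points as canonical generators\<close>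

lemma downset_maximal_points:
  assumes "Partial_order r" and "S \<subseteq> Field r"
    and lower: "\<And>x y. y \<in> S \<Longrightarrow> (x, y) \<in> r \<Longrightarrow> x \<in> S"
    and "S \<subseteq> downset r (maximal_points r S)"
  shows "S = downset r (maximal_points r S)"
  using assms by (auto simp: in_downset_iff maximal_points_def)

lemma antichain_maximal_points:
  "S \<subseteq> Field r \<Longrightarrow> antichain r (maximal_points r S)"
  by (auto simp: antichain_def maximal_points_def)

text \<open>Any generating set contains all maximal points, whence finiteness. Conversely, every
  point lies below a generator that is maximal among the generators, and such a generator is maximal
  in all of \<open>A\<close>.\<close>

lemma finitely_generated_maximal_points:
  assumes r: "Partial_order r" and A: "finitely_generated r A"
  shows "finite (maximal_points r A) \<and> A = downset r (maximal_points r A)"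
proof -
  obtain F where F: "finite F" "F \<subseteq> Field r" "A = downset r F"
    using A by (auto simp: finitely_generated_def)
  have "maximal_points r A \<subseteq> F"
    using subset_downset[OF r F(2)] unfolding F(3)
    by (auto simp: maximal_points_def) (metis in_downset_iff subsetD)
  then have fin: "finite (maximal_points r A)"
    using F(1) finite_subset by blast
  have "A \<subseteq> downset r (maximal_points r A)"
  proof
    fix x assume "x \<in> A"
    then obtain g where g: "g \<in> F" "(x, g) \<in> r"
      by (auto simp: F(3) in_downset_iff)
    \<comment> \<open>The generators above \<open>g\<close> form a finite nonempty set, so there is
      a maximal one \<open>h\<close> among them. A point \<open>y\<close> of \<open>A\<close> above
      \<open>h\<close> lies below some generator \<open>k\<close>, which is again in
      \<open>?H\<close>; then \<open>k = h\<close> and so \<open>y = h\<close>.\<close>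
    let ?H = "{h \<in> F. (g, h) \<in> r}"
    have "finite ?H" "?H \<noteq> {}"
      using F g Partial_order_refl[OF r] by auto
    moreover have "asymp_on ?H (\<lambda>u v. (u, v) \<in> r \<and> u \<noteq> v)"
      using Partial_order_antisym[OF r] by (auto intro!: asymp_onI)
    moreover have "transp_on ?H (\<lambda>u v. (u, v) \<in> r \<and> u \<noteq> v)"
      using Partial_order_trans[OF r] Partial_order_antisym[OF r] by (intro transp_onI) blast
    ultimately obtain h where h: "h \<in> ?H" "\<forall>k\<in>?H. k \<noteq> h \<longrightarrow> \<not> ((h, k) \<in> r \<and> h \<noteq> k)"
      using Finite_Set.bex_max_element[of ?H "\<lambda>u v. (u, v) \<in> r \<and> u \<noteq> v"] by blast
    have "y = h" if y: "y \<in> A" "(h, y) \<in> r" for y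
    proof -
      obtain k where k: "k \<in> F" "(y, k) \<in> r"
        using y(1) unfolding F(3) in_downset_iff by blast
      then have "(h, k) \<in> r" using Partial_order_trans[OF r] y(2) by blast
      moreover then have "(g, k) \<in> r" using Partial_order_trans[OF r] h(1) by blast
      ultimately have "k = h" using h(2) k(1) by blast
      then show ?thesis using Partial_order_antisym[OF r] y k by blast
    qed
    moreover have "h \<in> A" using h(1) F subset_downset[OF r F(2)] by blast
    ultimately have "h \<in> maximal_points r A" by (auto simp: maximal_points_def)
    moreover have "(x, h) \<in> r" using g h(1) Partial_order_trans[OF r] by blast
    ultimately show "x \<in> downset r (maximal_points r A)" by (auto simp: in_downset_iff)
  qed
  moreover have "x \<in> A" if "y \<in> A" "(x, y) \<in> r" for x y
    using that Partial_order_trans[OF r] unfolding F(3) in_downset_iff by blast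
  ultimately show ?thesis
    using fin downset_maximal_points[OF r finitely_generated_subset[OF A]] by blast
qed

lemma directed_subset_downset:
  assumes r: "Partial_order r" and D: "directed r D" and "finite F" and "D \<subseteq> downset r F"
  shows "\<exists>a\<in>F. D \<subseteq> downset r {a}"
  using assms(3,4)
proof (induction F rule: finite_induct)
  case empty
  then show ?case using D by (auto simp: directed_def downset_def)
next
  case (insert a F)
  show ?case
  proof (cases "D \<subseteq> downset r {a}")
    case False
    then have "\<exists>d\<in>D. (d, a) \<notin> r" by (auto simp: in_downset_iff)
    then obtain d where d: "d \<in> D" "(d, a) \<notin> r" by blast
    have "D \<subseteq> downset r F"
    proof
      fix x assume "x \<in> D"
      with D d(1) obtain z where z: "z \<in> D" "(x, z) \<in> r" "(d, z) \<in> r"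
        unfolding directed_def by blast
      then have "(z, a) \<notin> r" using d(2) Partial_order_trans[OF r] by blast
      moreover have "z \<in> downset r (insert a F)" using z insert.prems by blast
      ultimately obtain b where "b \<in> F" "(z, b) \<in> r"
        by (auto simp: in_downset_iff)
      then show "x \<in> downset r F"
        using Partial_order_trans[OF r z(2)] by (auto simp: in_downset_iff)
    qed
    then show ?thesis using insert.IH by blast
  qed auto
qed

text \<open>The directed set lies below a single generator, which is then an upper bound of it and
  so lies above its supremum.\<close>

lemma finitely_generated_supremum:
  assumes r: "Partial_order r" and "finitely_generated r A"
    and D: "directed r D" "D \<subseteq> A" and s: "is_supremum r D s"
  shows "s \<in> A"
proof -
  obtain F where F: "finite F" "F \<subseteq> Field r" "A = downset r F"
    using assms(2) by (auto simp: finitely_generated_def)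
  then obtain a where a: "a \<in> F" "D \<subseteq> downset r {a}"
    using directed_subset_downset[OF r D(1) F(1)] D(2) by blast
  then have "a \<in> Above r D"
    using F(2) by (auto simp: Above_def in_downset_iff)
  then show ?thesis
    using s a(1) F(3) by (auto simp: is_supremum_def in_downset_iff)
qed

section \<open>Controllable dcpos\<close>

text \<open>Zorn's lemma on the part of \<open>S\<close> above a given point: nonempty chains are
  directed, and closure of \<open>S\<close> under directed suprema keeps their upper bounds in
  \<open>S\<close>.\<close>

lemma dcpo_subset_downset_maximal_points:
  assumes r: "dcpo r" and S: "S \<subseteq> Field r"
    and sup: "\<And>D s. directed r D \<Longrightarrow> D \<subseteq> S \<Longrightarrow> is_supremum r D s \<Longrightarrow> s \<in> S"
  shows "S \<subseteq> downset r (maximal_points r S)"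
proof
  fix x assume x: "x \<in> S"
  have po: "Partial_order r" using r by (simp add: dcpo_def)
  let ?A = "{z \<in> S. (x, z) \<in> r}"
  let ?R = "relation_of (\<lambda>u v. (u, v) \<in> r) ?A"
  have "partial_order_on ?A ?R"
    unfolding relation_of_def partial_order_on_def preorder_on_def
    using S Partial_order_refl[OF po] Partial_order_trans[OF po] Partial_order_antisym[OF po]
    by (intro conjI refl_onI transI antisymI) blast+
  moreover have "\<exists>u\<in>?A. \<forall>a\<in>C. (a, u) \<in> r" if C: "C \<in> Chains ?R" for C
  proof (cases "C = {}")
    case True
    \<comment> \<open>The empty chain is bounded by \<open>x\<close> itself.\<close>
    then show ?thesis using x S Partial_order_refl[OF po] by blast
  next
    case False
    have CA: "C \<subseteq> ?A" "\<And>a b. a \<in> C \<Longrightarrow> b \<in> C \<Longrightarrow> (a, b) \<in> r \<or> (b, a) \<in> r"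
      using C by (auto simp: Chains_def relation_of_def)
    then have "directed r C"
      using False S Partial_order_refl[OF po] unfolding directed_def by blast
    moreover obtain s where s: "is_supremum r C s"
      using r calculation by (auto simp: dcpo_def)
    ultimately have "s \<in> S" using sup CA by blast
    moreover have above: "\<forall>a\<in>C. (a, s) \<in> r"
      using s by (auto simp: is_supremum_def Above_def)
    moreover have "(x, s) \<in> r"
      using False CA above Partial_order_trans[OF po] by blast
    ultimately show ?thesis by blast
  qed
  ultimately obtain m where m: "m \<in> ?A" "\<forall>a\<in>?A. (m, a) \<in> r \<longrightarrow> a = m"
    using predicate_Zorn[of ?A "\<lambda>u v. (u, v) \<in> r"] by blast
  \<comment> \<open>Maximality in \<open>?A\<close> is maximality in \<open>S\<close>, since
    whatever lies above \<open>m\<close> also lies above \<open>x\<close>.\<close>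
  then have "m \<in> maximal_points r S"
    using Partial_order_trans[OF po] unfolding maximal_points_def by blast
  then show "x \<in> downset r (maximal_points r S)"
    using m by (auto simp: in_downset_iff)
qed

text \<open>The intersection is closed under directed suprema, so it lies below the antichain of its
  maximal points. A cover of this antichain generates it: each member of \<open>\<A>\<close> is
  generated by a finite set that competes with the cover, so it contains the cover. Intersecting
  with \<open>Field r\<close> gives the empty family the value \<open>Field r\<close>.\<close>

lemma controllable_finitely_generated_Inter:
  assumes r: "controllable r" and \<A>: "\<And>A. A \<in> \<A> \<Longrightarrow> finitely_generated r A"
  shows "finitely_generated r (Field r \<inter> \<Inter>\<A>)"
proof -
  let ?S = "Field r \<inter> \<Inter>\<A>"
  have d: "dcpo r" and po: "Partial_order r"
    using r by (auto simp: controllable_def dcpo_def)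
  have "s \<in> ?S" if "directed r D" "D \<subseteq> ?S" "is_supremum r D s" for D s
  proof
    show "s \<in> Field r"
      using that(3) by (auto simp: is_supremum_def Above_def)
    show "s \<in> \<Inter>\<A>"
      using finitely_generated_supremum[OF po \<A> that(1) _ that(3)] that(2) by blast
  qed
  then have le: "?S \<subseteq> downset r (maximal_points r ?S)"
    by (intro dcpo_subset_downset_maximal_points[OF d]) auto
  obtain F where F: "is_cover r (maximal_points r ?S) F"
    using r antichain_maximal_points[of ?S r] by (auto simp: controllable_def)
  then have F': "finite F" "F \<subseteq> Field r" "maximal_points r ?S \<subseteq> downset r F"
    by (auto simp: is_cover_def antichain_def)
  have "?S \<subseteq> downset r F"
    using le F'(3) downset_subset_iff[OF po, of "maximal_points r ?S" F]
    by (auto simp: maximal_points_def)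
  moreover have "downset r F \<subseteq> A" if A: "A \<in> \<A>" for A
  proof -
    obtain G where G: "finite G" "G \<subseteq> Field r" "A = downset r G"
      using \<A>[OF A] by (auto simp: finitely_generated_def)
    moreover have "maximal_points r ?S \<subseteq> A"
      using A by (auto simp: maximal_points_def)
    ultimately have "F \<subseteq> downset r G"
      using F by (auto simp: is_cover_def)
    then show ?thesis
      using downset_subset_iff[OF po F'(2)] G by blast
  qed
  then have "downset r F \<subseteq> ?S"
    using downset_subset_Field[of r F] by blast
  ultimately have "?S = downset r F" by blast
  then show ?thesis using F' by (auto simp: finitely_generated_def)
qed

text \<open>Closure under intersections yields a least finitely generated lower set containing any
  given set. For an antichain its maximal points form a cover; for a directed set it has a greatest
  point, the supremum.\<close>

lemma controllableI:
  assumes po: "Partial_order r"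
    and Int: "\<And>\<A>. (\<And>A. A \<in> \<A> \<Longrightarrow> finitely_generated r A) \<Longrightarrow> finitely_generated r (Field r \<inter> \<Inter>\<A>)"
  shows "controllable r"
proof -
  \<comment> \<open>Stated for arbitrary \<open>B\<close>, because it is applied to directed sets as
    well as to antichains.\<close>
  have hull: "\<exists>F. finite F \<and> antichain r F \<and> B \<subseteq> downset r F \<and>
      (\<forall>G. finite G \<and> G \<subseteq> Field r \<and> B \<subseteq> downset r G \<longrightarrow> F \<subseteq> downset r G)"
    if B: "B \<subseteq> Field r" for B
  proof -
    let ?\<A> = "{A. finitely_generated r A \<and> B \<subseteq> A}"
    let ?S = "Field r \<inter> \<Inter>?\<A>"
    let ?F = "maximal_points r ?S"
    have "finitely_generated r ?S" by (rule Int) auto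
    then have F: "finite ?F" "?S = downset r ?F"
      using finitely_generated_maximal_points[OF po] by auto
    have "antichain r ?F" by (rule antichain_maximal_points) auto
    moreover have "B \<subseteq> downset r ?F"
      using B unfolding F(2)[symmetric] by blast
    moreover have "?F \<subseteq> downset r G" if "finite G" "G \<subseteq> Field r" "B \<subseteq> downset r G" for G
      using that finitely_generated_downset[of G r] by (auto simp: maximal_points_def)
    ultimately show ?thesis using F(1) by blast
  qed
  have "\<exists>s. is_supremum r D s" if D: "directed r D" for D
  proof -
    have DF: "D \<subseteq> Field r" using D by (auto simp: directed_def)
    obtain F where F: "finite F" "antichain r F" "D \<subseteq> downset r F"
      and le: "\<forall>G. finite G \<and> G \<subseteq> Field r \<and> D \<subseteq> downset r G \<longrightarrow> F \<subseteq> downset r G"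
      using hull[OF DF] by blast
    then obtain a where a: "a \<in> F" "D \<subseteq> downset r {a}"
      using directed_subset_downset[OF po D] by blast
    have "is_supremum r D a"
      unfolding is_supremum_def
    proof
      show "a \<in> Above r D"
        using a F(2) by (auto simp: Above_def in_downset_iff antichain_def)
      show "\<forall>u\<in>Above r D. (a, u) \<in> r"
      proof
        fix u assume "u \<in> Above r D"
        \<comment> \<open>An upper bound \<open>u\<close> of \<open>D\<close> makes
          \<open>{u}\<close> one of the competing sets \<open>G\<close>.\<close>
        then have "F \<subseteq> downset r {u}"
          by (intro le[rule_format]) (auto simp: Above_def in_downset_iff)
        then show "(a, u) \<in> r" using a by (auto simp: in_downset_iff)
      qed
    qed
    then show ?thesis ..
  qed
  moreover have "\<exists>F. is_cover r C F" if "antichain r C" for C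
    using hull[of C] that unfolding is_cover_def antichain_def by blast
  ultimately show ?thesis using po by (auto simp: controllable_def dcpo_def)
qed

section \<open>Spaces and orders\<close>

text \<open>With this orientation the closure of a point is its principal lower set, and closed sets
  are lower sets.\<close>

definition specialization_order :: "'a topology \<Rightarrow> 'a rel"
  where "specialization_order X = {(x, y). y \<in> topspace X \<and> x \<in> X closure_of {y}}"

text \<open>For controllable \<open>r\<close> this is the upper topology, generated by the
  complements of principal lower sets. The operator \<open>topology\<close> is meaningful only once
  the predicate is shown to be a topology, which is done below for controllable
  \<open>r\<close>.\<close>

definition lower_set_topology :: "'a rel \<Rightarrow> 'a topology"
  where "lower_set_topology r = topology (\<lambda>U. U \<subseteq> Field r \<and> finitely_generated r (Field r - U))"

section \<open>From co-Noetherian spaces to controllable dcpos\<close>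

lemma Field_specialization_order: "Field (specialization_order X) = topspace X"
proof -
  have "(x, x) \<in> specialization_order X" if "x \<in> topspace X" for x
    using that closure_of_subset[of "{x}" X] by (auto simp: specialization_order_def)
  moreover have "specialization_order X \<subseteq> topspace X \<times> topspace X"
    by (auto simp: specialization_order_def in_closure_of)
  ultimately show ?thesis unfolding Field_def by blast
qed

lemma Partial_order_specialization_order:
  assumes X: "t0_space X"
  shows "Partial_order (specialization_order X)"
  unfolding partial_order_on_def preorder_on_def Field_specialization_order
proof (intro conjI)
  show "specialization_order X \<subseteq> topspace X \<times> topspace X"
    by (auto simp: specialization_order_def in_closure_of)
  show "refl_on (topspace X) (specialization_order X)"
    using closure_of_subset[of "{_}" X] by (auto simp: specialization_order_def intro!: refl_onI)
  show "trans (specialization_order X)"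
    using closure_of_minimal[of "{_}" "X closure_of {_}" X]
    by (auto simp: specialization_order_def intro!: transI)
  show "antisym (specialization_order X)"
    using X by (intro antisymI) (auto simp: specialization_order_def t0_space_def in_closure_of)
qed

lemma downset_specialization_order:
  assumes "F \<subseteq> topspace X"
  shows "downset (specialization_order X) F = (\<Union>y\<in>F. X closure_of {y})"
  using assms unfolding set_eq_iff in_downset_iff specialization_order_def by blast

lemma closedin_finitely_generated:
  assumes "finitely_generated (specialization_order X) A"
  shows "closedin X A"
  using assms unfolding finitely_generated_def Field_specialization_order
  by (auto simp: downset_specialization_order intro!: closedin_Union)

text \<open>The complements of the lower sets generated by finite subsets of \<open>A\<close> form a
  filter basis of open sets whose intersection misses \<open>A\<close>. By the co-Noetherian
  property one of them already misses \<open>A\<close>, so finitely many points of \<open>A\<close>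
  generate it.\<close>

lemma co_noetherian_closedin_iff:
  assumes X: "co_noetherian_space X"
  shows "closedin X A \<longleftrightarrow> finitely_generated (specialization_order X) A"
proof
  assume A: "closedin X A"
  let ?r = "specialization_order X"
  have sub: "A \<subseteq> topspace X" using A closedin_subset by blast
  let ?\<U> = "{topspace X - downset ?r F |F. finite F \<and> F \<subseteq> A}"
  have "filter_basis ?\<U>"
    unfolding filter_basis_def
  proof (intro conjI ballI)
    show "?\<U> \<noteq> {}" by blast
    fix U V assume "U \<in> ?\<U>" "V \<in> ?\<U>"
    then obtain F G where "finite F" "F \<subseteq> A" "U = topspace X - downset ?r F"
      "finite G" "G \<subseteq> A" "V = topspace X - downset ?r G" by blast
    then show "\<exists>W\<in>?\<U>. W \<subseteq> U \<inter> V"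
      by (intro bexI[of _ "topspace X - downset ?r (F \<union> G)"])
        (auto simp: downset_Un intro!: exI[of _ "F \<union> G"])
  qed
  moreover have "openin X U" if U: "U \<in> ?\<U>" for U
  proof -
    obtain F where "finite F" "F \<subseteq> A" "U = topspace X - downset ?r F" using U by blast
    moreover from this sub have "closedin X (downset ?r F)"
      by (intro closedin_finitely_generated finitely_generated_downset)
        (auto simp: Field_specialization_order)
    ultimately show ?thesis by blast
  qed
  moreover have "\<Inter>?\<U> \<subseteq> topspace X - A"
  proof
    fix x assume x: "x \<in> \<Inter>?\<U>"
    \<comment> \<open>The member for \<open>F = {}\<close> is the whole space and so places
      \<open>x\<close> in \<open>topspace X\<close>; the member for \<open>{x}\<close> excludes
      \<open>x\<close> from \<open>A\<close>.\<close>
    then have "x \<in> topspace X - downset ?r {}" by blast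
    moreover have "x \<notin> A"
    proof
      assume "x \<in> A"
      with x have "x \<in> topspace X - downset ?r {x}" by blast
      then show False
        using closure_of_subset[of "{x}" X] by (auto simp: downset_specialization_order)
    qed
    ultimately show "x \<in> topspace X - A" by blast
  qed
  ultimately obtain U where "U \<in> ?\<U>" and U: "U \<subseteq> topspace X - A"
    using X A unfolding co_noetherian_space_def by (metis (no_types, lifting) openin_closedin_eq closedin_def)
  then obtain F where F: "finite F" "F \<subseteq> A" "U = topspace X - downset ?r F" by blast
  have "A \<subseteq> downset ?r F" using U sub F by blast
  moreover have "downset ?r F \<subseteq> A"
    using F sub closure_of_minimal[of "{_}" A X] A
    by (subst downset_specialization_order) blast+
  ultimately have "A = downset ?r F" by blast
  then show "finitely_generated ?r A"
    using F sub by (auto simp: finitely_generated_def Field_specialization_order)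
qed (rule closedin_finitely_generated)

lemma controllable_specialization_order:
  assumes "t0_space X" "co_noetherian_space X"
  shows "controllable (specialization_order X)"
proof (rule controllableI)
  show "Partial_order (specialization_order X)"
    using assms(1) by (rule Partial_order_specialization_order)
  fix \<A> :: "'a set set"
  assume "\<And>A. A \<in> \<A> \<Longrightarrow> finitely_generated (specialization_order X) A"
  \<comment> \<open>Inserting \<open>topspace X\<close> makes the family nonempty, as
    \<open>closedin_Inter\<close> requires, and matches the intersection with the field.\<close>
  then have "closedin X (\<Inter>(insert (topspace X) \<A>))"
    by (intro closedin_Inter) (auto intro: closedin_finitely_generated)
  then show "finitely_generated (specialization_order X) (Field (specialization_order X) \<inter> \<Inter>\<A>)"
    by (simp add: co_noetherian_closedin_iff[OF assms(2)] Field_specialization_order)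
qed

section \<open>From controllable dcpos to co-Noetherian spaces\<close>

text \<open>The topology axioms are read off the complements: binary unions give intersections of
  open sets, and arbitrary intersections, available by controllability, give unions of open
  sets.\<close>

lemma openin_lower_set_topology:
  assumes r: "controllable r"
  shows "openin (lower_set_topology r) U \<longleftrightarrow> U \<subseteq> Field r \<and> finitely_generated r (Field r - U)"
proof -
  let ?P = "\<lambda>U. U \<subseteq> Field r \<and> finitely_generated r (Field r - U)"
  have "istopology ?P"
    unfolding istopology_def
  proof (intro conjI allI impI; (elim conjE)?)
    fix S T assume "finitely_generated r (Field r - S)" "finitely_generated r (Field r - T)"
    then show "finitely_generated r (Field r - S \<inter> T)"
      by (simp add: Diff_Int finitely_generated_Un)
  next
    fix \<K> assume K: "\<forall>K\<in>\<K>. ?P K"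
    have "finitely_generated r (Field r \<inter> \<Inter>((\<lambda>K. Field r - K) ` \<K>))"
      using K by (intro controllable_finitely_generated_Inter[OF r]) auto
    moreover have "Field r \<inter> \<Inter>((\<lambda>K. Field r - K) ` \<K>) = Field r - \<Union>\<K>" by blast
    ultimately show "finitely_generated r (Field r - \<Union>\<K>)" by simp
  qed blast+
  then show ?thesis by (simp add: lower_set_topology_def)
qed

lemma topspace_lower_set_topology:
  assumes r: "controllable r"
  shows "topspace (lower_set_topology r) = Field r"
proof -
  have "openin (lower_set_topology r) (Field r)"
    by (simp add: openin_lower_set_topology[OF r] finitely_generated_empty)
  then show ?thesis
    unfolding topspace_def using openin_lower_set_topology[OF r] by blast
qed

lemma closedin_lower_set_topology:
  assumes r: "controllable r"
  shows "closedin (lower_set_topology r) A \<longleftrightarrow> finitely_generated r A"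
  using finitely_generated_subset[of r A]
  by (auto simp: closedin_def topspace_lower_set_topology[OF r] openin_lower_set_topology[OF r]
      double_diff)

text \<open>The smallest finitely generated lower set containing \<open>y\<close> is its principal
  lower set, so this is the closure of \<open>y\<close>.\<close>

lemma specialization_order_lower_set_topology:
  assumes r: "controllable r"
  shows "specialization_order (lower_set_topology r) = r"
proof -
  let ?X = "lower_set_topology r"
  have po: "Partial_order r" using r by (simp add: controllable_def dcpo_def)
  have cl: "?X closure_of {y} = downset r {y}" if y: "y \<in> Field r" for y
  proof
    show "?X closure_of {y} \<subseteq> downset r {y}"
      using y subset_downset[OF po, of "{y}"] finitely_generated_downset[of "{y}" r]
      by (intro closure_of_minimal) (auto simp: closedin_lower_set_topology[OF r])
    have "finitely_generated r (?X closure_of {y})"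
      using closedin_closure_of closedin_lower_set_topology[OF r] by blast
    then obtain F where F: "F \<subseteq> Field r" "?X closure_of {y} = downset r F"
      by (auto simp: finitely_generated_def)
    have "y \<in> ?X closure_of {y}"
      using y closure_of_subset[of "{y}" ?X] by (auto simp: topspace_lower_set_topology[OF r])
    then show "downset r {y} \<subseteq> ?X closure_of {y}"
      using F y downset_subset_iff[OF po, of "{y}" F] by simp
  qed
  show ?thesis
    unfolding specialization_order_def topspace_lower_set_topology[OF r]
    using cl FieldI2[of _ _ r] by (auto simp: in_downset_iff)
qed

lemma t0_space_lower_set_topology:
  assumes r: "controllable r"
  shows "t0_space (lower_set_topology r)"
  unfolding t0_space_def topspace_lower_set_topology[OF r]
proof (intro ballI impI)
  have po: "Partial_order r" using r by (simp add: controllable_def dcpo_def)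
  have op: "openin (lower_set_topology r) (Field r - downset r {y})" if "y \<in> Field r" for y
    using that finitely_generated_downset[of "{y}" r] downset_subset_Field[of r "{y}"]
    by (auto simp: openin_lower_set_topology[OF r] double_diff)
  fix x y assume xy: "x \<in> Field r" "y \<in> Field r" "x \<noteq> y"
  then consider "(x, y) \<notin> r" | "(y, x) \<notin> r" using Partial_order_antisym[OF po] by blast
  then show "\<exists>U. openin (lower_set_topology r) U \<and> (x \<notin> U \<longleftrightarrow> y \<in> U)"
  proof cases
    case 1
    then show ?thesis using xy op[of y] Partial_order_refl[OF po]
      by (intro exI[of _ "Field r - downset r {y}"]) (auto simp: in_downset_iff)
  next
    case 2
    then show ?thesis using xy op[of x] Partial_order_refl[OF po]
      by (intro exI[of _ "Field r - downset r {x}"]) (auto simp: in_downset_iff)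
  qed
qed

lemma filter_basis_finite_lower_bound:
  assumes "filter_basis \<U>" "finite \<V>" "\<V> \<subseteq> \<U>"
  shows "\<exists>W\<in>\<U>. \<forall>V\<in>\<V>. W \<subseteq> V"
  using assms(2,3)
proof (induction \<V> rule: finite_induct)
  case empty
  then show ?case using assms(1) by (auto simp: filter_basis_def)
next
  case (insert V \<V>)
  then obtain W where "W \<in> \<U>" "\<forall>V\<in>\<V>. W \<subseteq> V" by blast
  then show ?case
    using assms(1) insert.prems unfolding filter_basis_def
    by (metis insert_iff insert_subset le_inf_iff subset_trans)
qed

text \<open>The complement of \<open>V\<close> has finitely many generators, and each is missed by
  some member of the basis. A member contained in all of these misses every generator; its
  complement is a lower set and so contains the complement of \<open>V\<close>.\<close>

lemma co_noetherian_space_lower_set_topology: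
  assumes r: "controllable r"
  shows "co_noetherian_space (lower_set_topology r)"
  unfolding co_noetherian_space_def
proof (intro allI impI; elim conjE)
  have po: "Partial_order r" using r by (simp add: controllable_def dcpo_def)
  fix V \<U>
  assume V: "openin (lower_set_topology r) V" and \<U>: "filter_basis \<U>"
    and op: "\<forall>U\<in>\<U>. openin (lower_set_topology r) U" and sub: "\<Inter>\<U> \<subseteq> V"
  obtain F where F: "finite F" "F \<subseteq> Field r" "Field r - V = downset r F"
    using V by (auto simp: openin_lower_set_topology[OF r] finitely_generated_def)
  have "\<exists>U\<in>\<U>. x \<notin> U" if "x \<in> F" for x
    using that sub F subset_downset[OF po F(2)] by blast
  then obtain u where u: "\<And>x. x \<in> F \<Longrightarrow> u x \<in> \<U> \<and> x \<notin> u x" by metis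
  then obtain W where W: "W \<in> \<U>" "\<forall>x\<in>F. W \<subseteq> u x"
    using filter_basis_finite_lower_bound[OF \<U>, of "u ` F"] F(1) by blast
  obtain G where G: "G \<subseteq> Field r" "W \<subseteq> Field r" "Field r - W = downset r G"
    using W(1) op by (auto simp: openin_lower_set_topology[OF r] finitely_generated_def)
  have "F \<subseteq> downset r G" using W(2) u F(2) unfolding G(3)[symmetric] by blast
  then have "Field r - V \<subseteq> Field r - W"
    unfolding F(3) G(3) using downset_subset_iff[OF po F(2)] by blast
  then show "\<exists>U\<in>\<U>. U \<subseteq> V" using W(1) G(2) by blast
qed

lemma lower_set_topology_specialization_order:
  assumes X: "t0_space X" "co_noetherian_space X"
  shows "lower_set_topology (specialization_order X) = X"
  unfolding topology_eq
    openin_lower_set_topology[OF controllable_specialization_order[OF X]]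
    Field_specialization_order co_noetherian_closedin_iff[OF X(2), symmetric]
  by (auto simp: openin_closedin_eq)

section \<open>The two categories\<close>

text \<open>Continuity is tested on preimages of closed sets. Since preimages commute with finite
  unions, principal lower sets suffice; their preimages under a monotone map are lower sets,
  generated by their maximal points. Conversely, monotonicity follows because preimages of closed
  sets are lower sets.\<close>

lemma upper_continuous_iff_continuous_map:
  assumes r: "controllable r" and s: "controllable s"
  shows "upper_continuous r s f \<longleftrightarrow>
    continuous_map (lower_set_topology r) (lower_set_topology s) f"
proof -
  have por: "Partial_order r" and pos: "Partial_order s"
    using r s by (auto simp: controllable_def dcpo_def)
  let ?S = "\<lambda>B. {x \<in> Field r. f x \<in> B}"
  have cont: "continuous_map (lower_set_topology r) (lower_set_topology s) f \<longleftrightarrow>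
      f \<in> Field r \<rightarrow> Field s \<and>
      (\<forall>B. finitely_generated s B \<longrightarrow> finitely_generated r (?S B))"
    by (simp add: continuous_map_closedin closedin_lower_set_topology r s
        topspace_lower_set_topology)
  show ?thesis
    unfolding cont
  proof
    assume f: "upper_continuous r s f"
    then have fm: "\<And>x y. (x, y) \<in> r \<Longrightarrow> (f x, f y) \<in> s"
      by (simp add: upper_continuous_def)
    have 1: "finitely_generated r (?S (downset s {y}))" if "y \<in> Field s" for y
    proof -
      let ?M = "maximal_points r (?S (downset s {y}))"
      have fin: "finite ?M" and le: "?S (downset s {y}) \<subseteq> downset r ?M"
        using f that by (auto simp: upper_continuous_def Let_def)
      have "x \<in> ?S (downset s {y})" if "z \<in> ?S (downset s {y})" "(x, z) \<in> r" for x z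
        using that fm[OF that(2)] Partial_order_trans[OF pos]
        by (auto simp: in_downset_iff intro: FieldI1)
      then have "?S (downset s {y}) = downset r ?M"
        using downset_maximal_points[OF por _ _ le] by blast
      moreover have "?M \<subseteq> Field r" by (auto simp: maximal_points_def)
      ultimately show ?thesis using fin unfolding finitely_generated_def by blast
    qed
    have "finitely_generated r (?S B)" if B: "finitely_generated s B" for B
    proof -
      obtain G where G: "finite G" "G \<subseteq> Field s" "B = downset s G"
        using B by (auto simp: finitely_generated_def)
      then have "?S B = (\<Union>y\<in>G. ?S (downset s {y}))"
        by (auto simp: in_downset_iff)
      then show ?thesis
        using finitely_generated_UN[OF G(1), of r "\<lambda>y. ?S (downset s {y})"] 1 G(2) by auto
    qed
    then show "f \<in> Field r \<rightarrow> Field s \<and>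
        (\<forall>B. finitely_generated s B \<longrightarrow> finitely_generated r (?S B))"
      using f by (simp add: upper_continuous_def)
  next
    assume f: "f \<in> Field r \<rightarrow> Field s \<and>
        (\<forall>B. finitely_generated s B \<longrightarrow> finitely_generated r (?S B))"
    then have fg: "finitely_generated r (?S (downset s {y}))" if "y \<in> Field s" for y
      using finitely_generated_downset[of "{y}" s] that by auto
    have "(f x, f y) \<in> s" if xy: "(x, y) \<in> r" for x y
    proof -
      have y: "y \<in> Field r" "f y \<in> Field s" using xy f by (auto intro: FieldI2)
      obtain F where F: "?S (downset s {f y}) = downset r F"
        using fg[OF y(2)] by (auto simp: finitely_generated_def)
      \<comment> \<open>The preimage of the principal lower set of \<open>f y\<close> contains
        \<open>y\<close> and is a lower set, so it contains every \<open>x\<close> below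
        \<open>y\<close>.\<close>
      have "y \<in> ?S (downset s {f y})"
        using y Partial_order_refl[OF pos] by (auto simp: in_downset_iff)
      then have "x \<in> ?S (downset s {f y})"
        unfolding F using xy Partial_order_trans[OF por] by (auto simp: in_downset_iff)
      then show ?thesis by (auto simp: in_downset_iff)
    qed
    moreover have "finite (maximal_points r (?S (downset s {y})))"
      "?S (downset s {y}) \<subseteq> downset r (maximal_points r (?S (downset s {y})))"
      if "y \<in> Field s" for y
      using finitely_generated_maximal_points[OF por fg[OF that]] by blast+
    ultimately show "upper_continuous r s f"
      using f by (auto simp: upper_continuous_def Let_def)
  qed
qed

section \<open>Category axioms and their transport\<close>

lemma category_Co_NOE: "category (Co_NOE :: ('a topology, 'a \<Rightarrow> 'a) cat)"
proof
  fix X Y Z W :: "'a topology" and f g h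
  assume "f \<in> Hom Co_NOE X Y" "g \<in> Hom Co_NOE Y Z"
  \<comment> \<open>The inner \<open>compose\<close> is restricted to \<open>topspace Y\<close>, so
    associativity requires that \<open>f\<close> takes its values there.\<close>
  then have "f \<in> topspace X \<rightarrow> topspace Y"
    by (auto simp: Co_NOE_def continuous_map_def)
  then show "Comp Co_NOE X Y W (Comp Co_NOE Y Z W h g) f
      = Comp Co_NOE X Z W h (Comp Co_NOE X Y Z g f)"
    by (auto simp: Co_NOE_def compose_def fun_eq_iff)
qed (auto simp: Co_NOE_def compose_def extensional_def fun_eq_iff
    dest: continuous_map_funspace intro: continuous_map_eq[OF continuous_map_id]
      continuous_map_eq[OF continuous_map_compose])

text \<open>The hom-sets are literally equal, so both functors can leave maps unchanged, and the
  axioms for \<open>C_DCPO\<close> can be read off from those for \<open>Co_NOE\<close>.\<close>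

lemma Hom_C_DCPO:
  "r \<in> Obj C_DCPO \<Longrightarrow> s \<in> Obj C_DCPO \<Longrightarrow>
    Hom C_DCPO r s = Hom Co_NOE (lower_set_topology r) (lower_set_topology s)"
  by (auto simp: C_DCPO_def Co_NOE_def upper_continuous_iff_continuous_map
      topspace_lower_set_topology)

lemma Ident_C_DCPO:
  "r \<in> Obj C_DCPO \<Longrightarrow> Ident C_DCPO r = Ident Co_NOE (lower_set_topology r)"
  by (simp add: C_DCPO_def Co_NOE_def topspace_lower_set_topology)

lemma Comp_C_DCPO:
  "r \<in> Obj C_DCPO \<Longrightarrow>
    Comp C_DCPO r s t g f
      = Comp Co_NOE (lower_set_topology r) (lower_set_topology s) (lower_set_topology t) g f"
  by (simp add: C_DCPO_def Co_NOE_def topspace_lower_set_topology)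

lemma Obj_lower_set_topology: "r \<in> Obj C_DCPO \<Longrightarrow> lower_set_topology r \<in> Obj Co_NOE"
  by (simp add: C_DCPO_def Co_NOE_def t0_space_lower_set_topology
      co_noetherian_space_lower_set_topology)

lemma Obj_specialization_order: "X \<in> Obj Co_NOE \<Longrightarrow> specialization_order X \<in> Obj C_DCPO"
  by (simp add: C_DCPO_def Co_NOE_def controllable_specialization_order)

lemma category_C_DCPO: "category (C_DCPO :: ('a rel, 'a \<Rightarrow> 'a) cat)"
proof -
  interpret category "Co_NOE :: ('a topology, 'a \<Rightarrow> 'a) cat" by (rule category_Co_NOE)
  show ?thesis
    by standard
      (simp_all add: Hom_C_DCPO Ident_C_DCPO Comp_C_DCPO Obj_lower_set_topology ident_in_hom
        comp_in_hom[of _ "lower_set_topology _"] comp_ident_right comp_ident_left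
        comp_assoc[of _ "lower_set_topology _" "lower_set_topology _"])
qed

section \<open>The two functors and the equivalence\<close>

definition to_dcpo :: "('a topology, 'a \<Rightarrow> 'a, 'a rel, 'a \<Rightarrow> 'a) fctr"
  where "to_dcpo = \<lparr>on_obj = specialization_order, on_hom = (\<lambda>X Y f. f)\<rparr>"

definition to_space :: "('a rel, 'a \<Rightarrow> 'a, 'a topology, 'a \<Rightarrow> 'a) fctr"
  where "to_space = \<lparr>on_obj = lower_set_topology, on_hom = (\<lambda>r s f. f)\<rparr>"

lemma Co_NOE_lower_set_topology_specialization_order:
  "X \<in> Obj Co_NOE \<Longrightarrow> lower_set_topology (specialization_order X) = X"
  by (simp add: Co_NOE_def lower_set_topology_specialization_order)

lemma C_DCPO_specialization_order_lower_set_topology: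
  "r \<in> Obj C_DCPO \<Longrightarrow> specialization_order (lower_set_topology r) = r"
  by (simp add: C_DCPO_def specialization_order_lower_set_topology)

lemma is_functor_to_space: "is_functor C_DCPO Co_NOE to_space"
  by (intro is_functor.intro category_C_DCPO category_Co_NOE is_functor_axioms.intro)
    (simp_all add: to_space_def Obj_lower_set_topology Hom_C_DCPO Ident_C_DCPO Comp_C_DCPO)

lemma is_functor_to_dcpo: "is_functor Co_NOE C_DCPO to_dcpo"
  by (intro is_functor.intro category_C_DCPO category_Co_NOE is_functor_axioms.intro)
    (simp_all add: to_dcpo_def Obj_specialization_order Hom_C_DCPO Ident_C_DCPO Comp_C_DCPO
      Co_NOE_lower_set_topology_specialization_order)

text \<open>Agreement of the object maps is asked only on \<open>Obj C\<close>: the round trips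
  between spaces and orders return the original only for objects of the categories.\<close>

lemma is_functor_cong:
  assumes "is_functor C D F"
    and "\<And>a. a \<in> Obj C \<Longrightarrow> on_obj G a = on_obj F a"
    and "\<And>a b f. on_hom G a b f = on_hom F a b f"
  shows "is_functor C D G"
  using assms by (simp add: is_functor_def is_functor_axioms_def)

text \<open>When both functors agree on objects and maps, identities serve as components, and
  naturality reduces to the unit laws.\<close>

lemma natural_isomorphism_Ident:
  assumes F: "is_functor C D F"
    and obj: "\<And>a. a \<in> Obj C \<Longrightarrow> on_obj G a = on_obj F a"
    and hom: "\<And>a b f. on_hom G a b f = on_hom F a b f"
  shows "natural_isomorphism C D F G (\<lambda>a. Ident D (on_obj F a))"
proof -
  interpret F: is_functor C D F by fact
  have "is_functor C D G" using F obj hom by (rule is_functor_cong)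
  moreover have "isomorphism D (on_obj F a) (on_obj G a) (Ident D (on_obj F a))"
    if "a \<in> Obj C" for a
    using that F.on_obj F.D.ident_in_hom F.D.comp_ident_right
    by (auto simp: isomorphism_def obj)
  ultimately show ?thesis
    using F by (simp add: natural_isomorphism_def obj hom F.on_obj F.on_hom
        F.D.comp_ident_left F.D.comp_ident_right)
qed

lemma is_functor_id: "category C \<Longrightarrow> is_functor C C id_functor"
  by (simp add: is_functor_def is_functor_axioms_def id_functor_def)

theorem theorem4p22:
  shows "equivalent_categories
    (Co_NOE :: ('a topology, 'a \<Rightarrow> 'a) cat) (C_DCPO :: ('a rel, 'a \<Rightarrow> 'a) cat)"
proof -
  have "\<exists>\<eta>. natural_isomorphism (Co_NOE :: ('a topology, 'a \<Rightarrow> 'a) cat) Co_NOE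
      id_functor (comp_functor to_space to_dcpo) \<eta>"
    by (intro exI, rule natural_isomorphism_Ident[OF is_functor_id[OF category_Co_NOE]])
      (simp_all add: id_functor_def comp_functor_def to_space_def to_dcpo_def
        Co_NOE_lower_set_topology_specialization_order)
  \<comment> \<open>In the second transformation the composite is the source, so it must be known to
    be a functor before \<open>natural_isomorphism_Ident\<close> applies.\<close>
  moreover have "is_functor (C_DCPO :: ('a rel, 'a \<Rightarrow> 'a) cat) C_DCPO
      (comp_functor to_dcpo to_space)"
    by (rule is_functor_cong[OF is_functor_id[OF category_C_DCPO]])
      (simp_all add: id_functor_def comp_functor_def to_space_def to_dcpo_def
        C_DCPO_specialization_order_lower_set_topology)
  then have "\<exists>\<epsilon>. natural_isomorphism (C_DCPO :: ('a rel, 'a \<Rightarrow> 'a) cat) C_DCPO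
      (comp_functor to_dcpo to_space) id_functor \<epsilon>"
    by (intro exI, rule natural_isomorphism_Ident)
      (simp_all add: id_functor_def comp_functor_def to_space_def to_dcpo_def
        C_DCPO_specialization_order_lower_set_topology)
  ultimately show ?thesis
    unfolding equivalent_categories_def
    using is_functor_to_dcpo is_functor_to_space by blast
qed

end
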